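(* Let $n,r_1,\ldots,r_n$ be positive integers with $r_i\ge 2$ for each $i\in[n]$, let $t\in[n]$, and let $s=n$. The ideal $\widetilde{I}^{\langle n,t\rangle}$ of $R$ defines a rational normal curve.
   Context: Notation: $[r]=\{1,\ldots,r\}$, $\mathcal{N}=[r_1]\times\cdots\times[r_n]$, $\Bbbk$ is an arbitrary field. $R=\Bbbk[x_a: a\in\mathcal{N}]$ is the polynomial ring where the variables are identified by $x_a=x_b$ if and only if $\sum_{i=1}^n a_i=\sum_{i=1}^n b_i$ (this is the case $s=n$ of the general identification, in which $x_a=x_b$ if and only if $\sum_{i=1}^s a_i=\sum_{i=1}^s b_i$ and $a_i=b_i$ for $i>s$); thus $R$ has $\sum_{i=1}^n r_i-n+1$ variables. For $i\in[n]$ and $a,b\in\mathcal{N}$, $\mathrm{sw}(i,a,b)\in\mathcal{N}$ is obtained from $a$ by replacing its $i$-th component by $b_i$, and $f_{i,a,b}=x_ax_b-x_{\mathrm{sw}(i,a,b)}x_{\mathrm{sw}(i,b,a)}$. The ideal $\widetilde{I}^{\langle n,t\rangle}\subseteq R$ is generated by all $f_{i,a,b}$ with $a,b\in\mathcal{N}$ and $i\in[t]$. Equations for the rational normal curve in $\mathbb{P}^m$ are given by the $2\times 2$ minors of the $2\times m$ Hankel matrix $\begin{pmatrix} Z_1&Z_2&\cdots&Z_m\\ Z_2&Z_3&\cdots&Z_{m+1}\end{pmatrix}$ whose entries are the $m+1$ homogeneous coordinates; here $m=\sum_{i=1}^n r_i-n$, and the variables of $R$ are identified with the homogeneous coordinates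 of $\mathbb{P}^m$.
   Formalization: The case n = 1 with r_1 ≥ 3 is excluded: there every f_{1,a,b} is zero, so the ideal is zero and defines all of P^{r_1-1}, which is not a curve; n = 1, r_1 = 2 and all n ≥ 2 are covered. *)

theory Defs
  imports "HOL-Algebra.Ideal" "HOL-Library.Poly_Mapping"
begin

section \<open>Polynomial rings\<close>

text \<open>
  A polynomial in variables indexed by natural numbers is a finitely supported function from
  monomials (finitely supported exponent functions) to coefficients.  The type provides infinitely
  many variables; \<^term>\<open>poly_ring V\<close> is the ring \<open>k[Z\<^sub>j : j \<in> V]\<close>.
\<close>

type_synonym 'k mpoly = "(nat \<Rightarrow>\<^sub>0 nat) \<Rightarrow>\<^sub>0 'k"

definition poly_ring :: "nat set \<Rightarrow> 'k::comm_ring_1 mpoly ring" where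
  "poly_ring V =
    \<lparr>carrier = {p. \<forall>\<mu>\<in>Poly_Mapping.keys p. Poly_Mapping.keys \<mu> \<subseteq> V},
     monoid.mult = (*), one = 1, zero = 0, add = (+)\<rparr>"

definition coord :: "nat \<Rightarrow> 'k::comm_ring_1 mpoly" where
  "coord j = Poly_Mapping.single (Poly_Mapping.single j 1) 1"

lemma cring_poly_ring: "cring (poly_ring V :: 'k::comm_ring_1 mpoly ring)"
proof (rule cringI)
  show "abelian_group (poly_ring V :: 'k mpoly ring)"
  proof (rule abelian_groupI)
    fix p q :: "'k mpoly"
    assume "p \<in> carrier (poly_ring V)" "q \<in> carrier (poly_ring V)"
    then show "p \<oplus>\<^bsub>poly_ring V\<^esub> q \<in> carrier (poly_ring V)"
      using keys_add[of p q] by (auto simp: poly_ring_def)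
  next
    fix p :: "'k mpoly"
    assume "p \<in> carrier (poly_ring V)"
    then show "\<exists>q\<in>carrier (poly_ring V). q \<oplus>\<^bsub>poly_ring V\<^esub> p = \<zero>\<^bsub>poly_ring V\<^esub>"
      by (intro bexI[of _ "- p"]) (auto simp: poly_ring_def in_keys_iff)
  qed (auto simp: poly_ring_def algebra_simps)
  show "Group.comm_monoid (poly_ring V :: 'k mpoly ring)"
  proof (rule comm_monoidI)
    fix p q :: "'k mpoly"
    assume *: "p \<in> carrier (poly_ring V)" "q \<in> carrier (poly_ring V)"
    have "Poly_Mapping.keys \<mu> \<subseteq> V" if \<mu>: "\<mu> \<in> Poly_Mapping.keys (p * q)" for \<mu>
    proof -
      obtain \<alpha> \<beta> where "\<mu> = \<alpha> + \<beta>" "\<alpha> \<in> Poly_Mapping.keys p" "\<beta> \<in> Poly_Mapping.keys q"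
        using \<mu> keys_mult[of p q] by blast
      then show ?thesis
        using * keys_add[of \<alpha> \<beta>] unfolding poly_ring_def by fastforce
    qed
    then show "p \<otimes>\<^bsub>poly_ring V\<^esub> q \<in> carrier (poly_ring V)"
      by (auto simp: poly_ring_def)
  qed (auto simp: poly_ring_def algebra_simps)
qed (auto simp: poly_ring_def algebra_simps)

lemma coord_in_poly_ring: "j \<in> V \<Longrightarrow> coord j \<in> carrier (poly_ring V)"
  by (simp add: coord_def poly_ring_def)

lemma coord_eq_iff: "(coord i :: 'k::comm_ring_1 mpoly) = coord j \<longleftrightarrow> i = j"
proof
  assume "(coord i :: 'k mpoly) = coord j"
  then have "Poly_Mapping.keys (coord i :: 'k mpoly) = Poly_Mapping.keys (coord j :: 'k mpoly)"
    by simp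
  then have "Poly_Mapping.keys (Poly_Mapping.single i (1::nat)) =
      Poly_Mapping.keys (Poly_Mapping.single j (1::nat))"
    unfolding coord_def by simp
  then show "i = j" by simp
qed simp


section \<open>The ideal generated by the swap binomials\<close>

definition index_set :: "nat \<Rightarrow> (nat \<Rightarrow> nat) \<Rightarrow> (nat \<Rightarrow> nat) set" where
  "index_set n r = (\<Pi>\<^sub>E i\<in>{1..n}. {1..r i})"

definition sw :: "nat \<Rightarrow> (nat \<Rightarrow> nat) \<Rightarrow> (nat \<Rightarrow> nat) \<Rightarrow> (nat \<Rightarrow> nat)" where
  "sw i a b = a(i := b i)"

definition mdim :: "nat \<Rightarrow> (nat \<Rightarrow> nat) \<Rightarrow> nat" where
  "mdim n r = (\<Sum>i=1..n. r i) - n"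

text \<open>
  The variable attached to \<open>a\<close> is the homogeneous coordinate numbered by the sum of the
  entries of \<open>a\<close>, shifted so that numbering starts at 1; see \<open>xvar_eq_iff\<close> and \<open>xvar_image\<close> below.
\<close>

definition xvar :: "nat \<Rightarrow> (nat \<Rightarrow> nat) \<Rightarrow> 'k::comm_ring_1 mpoly" where
  "xvar n a = coord ((\<Sum>i=1..n. a i) - n + 1)"

definition Rring :: "nat \<Rightarrow> (nat \<Rightarrow> nat) \<Rightarrow> 'k::comm_ring_1 mpoly ring" where
  "Rring n r = poly_ring {1..mdim n r + 1}"

definition swap_binomial ::
    "nat \<Rightarrow> nat \<Rightarrow> (nat \<Rightarrow> nat) \<Rightarrow> (nat \<Rightarrow> nat) \<Rightarrow> 'k::comm_ring_1 mpoly" where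
  "swap_binomial n i a b = xvar n a * xvar n b - xvar n (sw i a b) * xvar n (sw i b a)"

definition swap_ideal :: "nat \<Rightarrow> (nat \<Rightarrow> nat) \<Rightarrow> nat \<Rightarrow> 'k::comm_ring_1 mpoly set" where
  "swap_ideal n r t =
    genideal (Rring n r)
      {swap_binomial n i a b | i a b. i \<in> {1..t} \<and> a \<in> index_set n r \<and> b \<in> index_set n r}"

lemma sum_index_set_ge: "a \<in> index_set n r \<Longrightarrow> n \<le> (\<Sum>i=1..n. a i)"
  using sum_mono[of "{1..n}" "\<lambda>_. 1" a] by (force simp: index_set_def PiE_iff)

lemma xvar_eq_iff:
  assumes "a \<in> index_set n r" "b \<in> index_set n r"
  shows "(xvar n a :: 'k::comm_ring_1 mpoly) = xvar n b \<longleftrightarrow> (\<Sum>i=1..n. a i) = (\<Sum>i=1..n. b i)"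
  using sum_index_set_ge[OF assms(1)] sum_index_set_ge[OF assms(2)]
  by (auto simp: xvar_def coord_eq_iff)

lemma ex_index_sum:
  assumes "\<forall>i\<in>{1..n}. 1 \<le> r i" "n \<le> k" "k \<le> (\<Sum>i=1..n. r i)"
  shows "\<exists>a\<in>index_set n r. (\<Sum>i=1..n. a i) = k"
  using assms
proof (induction n arbitrary: k)
  case 0
  then show ?case by (auto simp: index_set_def)
next
  case (Suc n)
  have ge: "n \<le> (\<Sum>i=1..n. r i)"
    using sum_mono[of "{1..n}" "\<lambda>_. 1" r] Suc.prems(1) by force
  define c where "c = min (r (Suc n)) (k - n)"
  have c: "1 \<le> c" "c \<le> r (Suc n)" "c \<le> k"
    using Suc.prems by (auto simp: c_def)
  have "n \<le> k - c" "k - c \<le> (\<Sum>i=1..n. r i)"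
    using Suc.prems ge by (auto simp: c_def)
  then obtain a where a: "a \<in> index_set n r" "(\<Sum>i=1..n. a i) = k - c"
    using Suc.IH[of "k - c"] Suc.prems(1) by force
  have "a(Suc n := c) \<in> index_set (Suc n) r"
    using a(1) c by (auto simp: index_set_def PiE_iff extensional_def le_Suc_eq)
  moreover have "(\<Sum>i=1..Suc n. (a(Suc n := c)) i) = k"
    using a(2) c by simp
  ultimately show ?case by blast
qed

lemma xvar_image:
  assumes "\<forall>i\<in>{1..n}. 1 \<le> r i"
  shows "(xvar n ` index_set n r :: 'k::comm_ring_1 mpoly set) = coord ` {1..mdim n r + 1}"
proof (intro equalityI subsetI)
  fix p :: "'k mpoly"
  assume "p \<in> xvar n ` index_set n r"
  then obtain a where a: "a \<in> index_set n r" "p = xvar n a" by blast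
  have "(\<Sum>i=1..n. a i) \<le> (\<Sum>i=1..n. r i)"
    using a(1) by (intro sum_mono) (auto simp: index_set_def PiE_iff)
  then show "p \<in> coord ` {1..mdim n r + 1}"
    using a(2) by (auto simp: xvar_def mdim_def)
next
  fix p :: "'k mpoly"
  assume "p \<in> coord ` {1..mdim n r + 1}"
  then obtain j where j: "1 \<le> j" "j \<le> mdim n r + 1" "p = coord j" by auto
  have "n \<le> (\<Sum>i=1..n. r i)"
    using sum_mono[of "{1..n}" "\<lambda>_. 1" r] assms by force
  then obtain a where a: "a \<in> index_set n r" "(\<Sum>i=1..n. a i) = n + j - 1"
    using ex_index_sum[OF assms, of "n + j - 1"] j \<open>n \<le> _\<close>
    by (force simp: mdim_def)
  then have "p = xvar n a" using j by (simp add: xvar_def)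
  then show "p \<in> xvar n ` index_set n r" using a(1) by blast
qed


section \<open>The rational normal curve\<close>

text \<open>Entry of the \<open>2 \<times> m\<close> Hankel matrix in row \<open>i \<in> {1, 2}\<close> and column \<open>j \<in> {1..m}\<close>.\<close>

definition hankel :: "nat \<Rightarrow> nat \<Rightarrow> 'k::comm_ring_1 mpoly" where
  "hankel i j = coord (i + j - 1)"

definition hankel_ideal :: "nat \<Rightarrow> 'k::comm_ring_1 mpoly set" where
  "hankel_ideal m =
    genideal (poly_ring {1..m + 1})
      {hankel 1 j * hankel 2 l - hankel 1 l * hankel 2 j | j l. 1 \<le> j \<and> j < l \<and> l \<le> m}"

text \<open>
  Points of projective \<open>m\<close>-space over a field \<open>L\<close> are represented by all their vectors of homogeneous
  coordinates; a set of points is thus a set of nonzero vectors closed under nonzero scaling.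
\<close>

definition homogeneous_coords :: "nat \<Rightarrow> (nat \<Rightarrow> 'l::field) set" where
  "homogeneous_coords m = {z \<in> {1..m + 1} \<rightarrow>\<^sub>E UNIV. \<exists>j\<in>{1..m + 1}. z j \<noteq> 0}"

text \<open>The image of the projective line under \<open>[u : v] \<mapsto> [u\<^sup>m : u\<^sup>m\<^sup>-\<^sup>1 v : \<dots> : v\<^sup>m]\<close>.\<close>

definition rational_normal_curve :: "nat \<Rightarrow> (nat \<Rightarrow> 'l::field) set" where
  "rational_normal_curve m =
    {z \<in> homogeneous_coords m. \<exists>u v c. (u \<noteq> 0 \<or> v \<noteq> 0) \<and> c \<noteq> 0 \<and>
       (\<forall>j\<in>{1..m + 1}. z j = c * (u ^ (m + 1 - j) * v ^ (j - 1)))}"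

text \<open>Extension fields of \<open>k\<close> are given by homomorphisms \<open>h\<close> from \<open>k\<close> to another field.\<close>

definition field_hom :: "('k::field \<Rightarrow> 'l::field) \<Rightarrow> bool" where
  "field_hom h \<longleftrightarrow> h 1 = 1 \<and> (\<forall>c d. h (c + d) = h c + h d) \<and> (\<forall>c d. h (c * d) = h c * h d)"

definition eval_at :: "('k::field \<Rightarrow> 'l::field) \<Rightarrow> (nat \<Rightarrow> 'l) \<Rightarrow> 'k mpoly \<Rightarrow> 'l" where
  "eval_at h z p =
    (\<Sum>\<mu>\<in>Poly_Mapping.keys p. h (Poly_Mapping.lookup p \<mu>) *
       (\<Prod>j\<in>Poly_Mapping.keys \<mu>. z j ^ Poly_Mapping.lookup \<mu> j))"

definition zero_locus :: "('k::field \<Rightarrow> 'l::field) \<Rightarrow> nat \<Rightarrow> 'k mpoly set \<Rightarrow> (nat \<Rightarrow> 'l) set" where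
  "zero_locus h m I = {z \<in> homogeneous_coords m. \<forall>p\<in>I. eval_at h z p = 0}"

end

theory Submission
  imports Defs
begin

text \<open>
  Write \<open>Z\<^sub>j\<close> for \<open>coord j\<close> and \<open>m\<close> for \<open>mdim n r\<close>.  Swapping one entry between two indices \<open>a\<close>, \<open>b\<close> preserves the
  total of their entry sums, so every swap binomial is balanced: it has the form
  \<open>Z\<^sub>u Z\<^sub>v - Z\<^sub>u\<^sub>' Z\<^sub>v\<^sub>'\<close> with \<open>u + v = u' + v'\<close>.  So is every Hankel minor.  Hence it is enough that
  both ideals contain all balanced binomials with indices in \<open>{1..m + 1}\<close>.

  This follows from a rewriting argument (\<open>ideal_contains_balanced_binomials\<close>): if, modulo an ideal,
  each product \<open>Z\<^sub>u Z\<^sub>v\<close> with \<open>v - u \<ge> 2\<close> equals a product whose two indices have the same sum and lie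
  strictly between \<open>u\<close> and \<open>v\<close>, then it reduces to the product of the two middle indices, which
  depends on \<open>u + v\<close> alone.  The Hankel minor of columns \<open>u\<close> and \<open>v - 1\<close> gives a move of step one.  Swaps
  in the first entry alone also give an inward move (\<open>swap_ideal_inward_move\<close>): represent \<open>u\<close> and \<open>v\<close> by indices
  such that the one for \<open>v\<close> has both the larger first entry and the larger sum of the other entries;
  exchanging the first entries then moves both sums inwards.  This is why \<open>t = 1\<close>
  already yields the whole ideal.  It requires a second factor; for \<open>n = 1\<close> and \<open>r 1 = 2\<close> there are
  only two coordinates, no pair is at distance two, and both ideals vanish.

  For the zero locus, evaluation at a point is a ring homomorphism, so a point is a zero of the ideal
  exactly if all Hankel minors vanish there.  If \<open>z 1 \<noteq> 0\<close>, these equations make the coordinates a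
  geometric progression; if \<open>z 1 = 0\<close>, they force every coordinate but the last to vanish
  (\<open>on_rational_normal_curve_iff\<close>).
\<close>

section \<open>Quadratic binomials with a common index sum\<close>

text \<open>
  Generators and congruences are written with the subtraction of the type; this lemma replaces the
  record's own negation \<open>\<ominus>\<close> by multiplication with the constant \<open>- 1\<close>.
\<close>

lemma poly_ring_ideal_diff:
  fixes I :: "'k::comm_ring_1 mpoly set"
  assumes I: "ideal I (poly_ring V)" and "p \<in> I" "q \<in> I"
  shows "p - q \<in> I"
proof -
  have "- 1 \<in> carrier (poly_ring V :: 'k mpoly ring)"
    by (auto simp: poly_ring_def in_keys_iff lookup_one when_def split: if_splits)
  then have "- 1 * q \<in> I"
    using ideal.I_l_closed[OF I \<open>q \<in> I\<close>, of "- 1"] by (simp add: poly_ring_def)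
  then have "p + - 1 * q \<in> I"
    using additive_subgroup.a_closed[OF ideal.axioms(1)[OF I] \<open>p \<in> I\<close>, of "- 1 * q"]
    by (simp add: poly_ring_def)
  then show ?thesis by simp
qed

lemma coord_binomial_closed:
  assumes "u \<in> V" "v \<in> V" "u' \<in> V" "v' \<in> V"
  shows "(coord u * coord v - coord u' * coord v' :: 'k::comm_ring_1 mpoly) \<in> carrier (poly_ring V)"
proof -
  interpret P: cring "poly_ring V :: 'k mpoly ring" by (rule cring_poly_ring)
  have "coord i * coord j \<in> carrier (poly_ring V :: 'k mpoly ring)" if "i \<in> V" "j \<in> V" for i j
    using P.m_closed[OF coord_in_poly_ring[OF that(1)] coord_in_poly_ring[OF that(2)]]
    by (simp add: poly_ring_def)
  then show ?thesis
    using poly_ring_ideal_diff[OF P.oneideal] assms by blast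
qed

text \<open>
  Strong induction on \<open>v - u\<close>: repeated moves bring every product to that of the two middle indices
  of its index sum.  Two products with equal index sums therefore have the same normal form, and
  their difference lies in the ideal.
\<close>

lemma ideal_contains_balanced_binomials:
  fixes I :: "'k::comm_ring_1 mpoly set"
  assumes I: "ideal I (poly_ring V)"
    and move: "\<And>u v. u \<in> {1..N} \<Longrightarrow> v \<in> {1..N} \<Longrightarrow> u + 2 \<le> v \<Longrightarrow>
      \<exists>w. u < w \<and> w < v \<and> coord u * coord v - coord w * coord (u + v - w) \<in> I"
    and mem: "u \<in> {1..N}" "v \<in> {1..N}" "u' \<in> {1..N}" "v' \<in> {1..N}"
    and sum: "u + v = u' + v'"
  shows "coord u * coord v - coord u' * coord v' \<in> I"
proof -
  define middle :: "nat \<Rightarrow> 'k mpoly" where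
    "middle s = coord (s div 2) * coord (s - s div 2)" for s
  have zero: "0 \<in> I"
    using additive_subgroup.zero_closed[OF ideal.axioms(1)[OF I]] by (simp add: poly_ring_def)
  have add: "p + q \<in> I" if "p \<in> I" "q \<in> I" for p q
    using additive_subgroup.a_closed[OF ideal.axioms(1)[OF I] that] by (simp add: poly_ring_def)
  have ordered: "coord u * coord v - middle (u + v) \<in> I"
    if "u \<in> {1..N}" "v \<in> {1..N}" "u \<le> v" for u v
    using that
  proof (induction "v - u" arbitrary: u v rule: less_induct)
    case less
    show ?case
    proof (cases "u + 2 \<le> v")
      case False
      then consider "v = u" | "v = Suc u" using less.prems by linarith
      then show ?thesis
      proof cases
        case 1
        then show ?thesis using zero by (simp add: middle_def)
      next
        case 2
        have "(u + Suc u) div 2 = u" by simp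
        then have "middle (u + v) = coord u * coord v" by (simp add: middle_def 2)
        then show ?thesis using zero by simp
      qed
    next
      case True
      then obtain w where w: "u < w" "w < v"
        and step: "coord u * coord v - coord w * coord (u + v - w) \<in> I"
        using move less.prems by blast
      \<comment> \<open>The move may land in either order, since \<open>w\<close> can lie on either side of the middle.\<close>
      have "coord w * coord (u + v - w) - middle (u + v) \<in> I"
      proof (cases "w \<le> u + v - w")
        case True
        then show ?thesis
          using less.hyps[of "u + v - w" w] less.prems w by simp
      next
        case False
        then show ?thesis
          using less.hyps[of w "u + v - w"] less.prems w by (simp add: mult.commute)
      qed
      from add[OF step this] show ?thesis by simp
    qed
  qed
  have to_middle: "coord u * coord v - middle (u + v) \<in> I"
    if "u \<in> {1..N}" "v \<in> {1..N}" for u v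
    using ordered[OF that] ordered[OF that(2,1)] by (cases "u \<le> v") (simp_all add: ac_simps)
  show ?thesis
    using poly_ring_ideal_diff[OF I to_middle[OF mem(1,2)] to_middle[OF mem(3,4)]] sum by simp
qed

section \<open>The Hankel ideal\<close>

lemma hankel_minors_subset_carrier:
  "{hankel 1 j * hankel 2 l - hankel 1 l * hankel 2 j | j l. 1 \<le> j \<and> j < l \<and> l \<le> m}
    \<subseteq> carrier (poly_ring {1..m + 1} :: 'k::comm_ring_1 mpoly ring)"
proof (clarify, goal_cases)
  case (1 p j l)
  then show ?case
    using coord_binomial_closed[of j "{1..m + 1}" "l + 1" l "j + 1"] by (simp add: hankel_def)
qed

lemma ideal_hankel_ideal: "ideal (hankel_ideal m :: 'k::comm_ring_1 mpoly set) (poly_ring {1..m + 1})"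
proof -
  interpret P: cring "poly_ring {1..m + 1} :: 'k mpoly ring" by (rule cring_poly_ring)
  show ?thesis
    unfolding hankel_ideal_def by (rule P.genideal_ideal[OF hankel_minors_subset_carrier])
qed

lemma hankel_minor_in_hankel_ideal:
  assumes "1 \<le> j" "j < l" "l \<le> m"
  shows "(coord j * coord (l + 1) - coord l * coord (j + 1) :: 'k::comm_ring_1 mpoly) \<in> hankel_ideal m"
proof -
  interpret P: cring "poly_ring {1..m + 1} :: 'k mpoly ring" by (rule cring_poly_ring)
  have "hankel 1 j * hankel 2 l - hankel 1 l * hankel 2 j \<in> (hankel_ideal m :: 'k mpoly set)"
    using P.genideal_self[OF hankel_minors_subset_carrier] assms
    unfolding hankel_ideal_def by blast
  then show ?thesis using assms by (simp add: hankel_def)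
qed

text \<open>
  The minor of columns \<open>u\<close> and \<open>v - 1\<close> is \<open>Z\<^sub>u Z\<^sub>v - Z\<^sub>v\<^sub>-\<^sub>1 Z\<^sub>u\<^sub>+\<^sub>1\<close>, a move of step one.
\<close>

lemma hankel_ideal_contains_balanced_binomials:
  assumes "u \<in> {1..m + 1}" "v \<in> {1..m + 1}" "u' \<in> {1..m + 1}" "v' \<in> {1..m + 1}"
    and "u + v = u' + v'"
  shows "(coord u * coord v - coord u' * coord v' :: 'k::comm_ring_1 mpoly) \<in> hankel_ideal m"
proof (rule ideal_contains_balanced_binomials[OF ideal_hankel_ideal _ assms])
  fix u v assume uv: "u \<in> {1..m + 1}" "v \<in> {1..m + 1}" "u + 2 \<le> v"
  then have "coord u * coord v - coord (u + 1) * coord (u + v - (u + 1)) \<in> (hankel_ideal m :: 'k mpoly set)"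
    using hankel_minor_in_hankel_ideal[of u "v - 1" m, where 'k='k] by (simp add: mult.commute)
  then show "\<exists>w. u < w \<and> w < v \<and>
      coord u * coord v - coord w * coord (u + v - w) \<in> (hankel_ideal m :: 'k mpoly set)"
    using uv by (intro exI[of _ "u + 1"]) auto
qed

section \<open>The swap ideal\<close>

lemma coord_number_mem:
  assumes "a \<in> index_set n r"
  shows "(\<Sum>i=1..n. a i) - n + 1 \<in> {1..mdim n r + 1}"
proof -
  have "(\<Sum>i=1..n. a i) \<le> (\<Sum>i=1..n. r i)"
    using assms by (intro sum_mono) (auto simp: index_set_def PiE_iff)
  then show ?thesis by (simp add: mdim_def diff_le_mono)
qed

lemma sw_mem_index_set:
  "a \<in> index_set n r \<Longrightarrow> b \<in> index_set n r \<Longrightarrow> i \<in> {1..n} \<Longrightarrow> sw i a b \<in> index_set n r"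
  by (auto simp: sw_def index_set_def PiE_iff extensional_def)

lemma sum_fun_upd:
  fixes a :: "nat \<Rightarrow> nat"
  assumes "i \<in> {1..n}"
  shows "(\<Sum>j=1..n. (a(i := c)) j) + a i = (\<Sum>j=1..n. a j) + c"
proof -
  have "(\<Sum>j\<in>{1..n} - {i}. (a(i := c)) j) = (\<Sum>j\<in>{1..n} - {i}. a j)"
    by (rule sum.cong) auto
  then show ?thesis
    using sum.remove[of "{1..n}" i "a(i := c)"] sum.remove[of "{1..n}" i a] assms by simp
qed

lemma sum_sw_add_sum_sw:
  assumes "i \<in> {1..n}"
  shows "(\<Sum>j=1..n. sw i a b j) + (\<Sum>j=1..n. sw i b a j) = (\<Sum>j=1..n. a j) + (\<Sum>j=1..n. b j)"
  using sum_fun_upd[OF assms, of a "b i"] sum_fun_upd[OF assms, of b "a i"]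
  by (simp add: sw_def)

lemma swap_binomial_balanced:
  assumes i: "i \<in> {1..n}" and a: "a \<in> index_set n r" and b: "b \<in> index_set n r"
  obtains u v u' v' where
    "u \<in> {1..mdim n r + 1}" "v \<in> {1..mdim n r + 1}"
    "u' \<in> {1..mdim n r + 1}" "v' \<in> {1..mdim n r + 1}"
    "u + v = u' + v'"
    "(swap_binomial n i a b :: 'k::comm_ring_1 mpoly) = coord u * coord v - coord u' * coord v'"
proof -
  note sw = sw_mem_index_set[OF a b i] sw_mem_index_set[OF b a i]
  have "((\<Sum>j=1..n. a j) - n + 1) + ((\<Sum>j=1..n. b j) - n + 1) =
      ((\<Sum>j=1..n. sw i a b j) - n + 1) + ((\<Sum>j=1..n. sw i b a j) - n + 1)"
    using sum_sw_add_sum_sw[OF i, of a b]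
      sum_index_set_ge[OF a] sum_index_set_ge[OF b]
      sum_index_set_ge[OF sw(1)] sum_index_set_ge[OF sw(2)] by linarith
  then show thesis
    using that[OF coord_number_mem[OF a] coord_number_mem[OF b]
        coord_number_mem[OF sw(1)] coord_number_mem[OF sw(2)]]
    unfolding swap_binomial_def xvar_def by blast
qed

lemma swap_binomials_subset_carrier:
  assumes "t \<le> n"
  shows "{swap_binomial n i a b | i a b. i \<in> {1..t} \<and> a \<in> index_set n r \<and> b \<in> index_set n r}
    \<subseteq> carrier (Rring n r :: 'k::comm_ring_1 mpoly ring)"
proof (clarify, goal_cases)
  case (1 p i a b)
  then have "i \<in> {1..n}" using assms by auto
  from this 1(2,3) show ?case
    unfolding Rring_def
    by (rule swap_binomial_balanced) (erule ssubst, rule coord_binomial_closed)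
qed

lemma ideal_swap_ideal:
  assumes "t \<le> n"
  shows "ideal (swap_ideal n r t :: 'k::comm_ring_1 mpoly set) (poly_ring {1..mdim n r + 1})"
proof -
  interpret P: cring "Rring n r :: 'k mpoly ring" unfolding Rring_def by (rule cring_poly_ring)
  show ?thesis
    using P.genideal_ideal[OF swap_binomials_subset_carrier[OF assms]]
    unfolding swap_ideal_def by (simp add: Rring_def)
qed

lemma swap_binomial_in_swap_ideal:
  assumes "t \<le> n" "i \<in> {1..t}" "a \<in> index_set n r" "b \<in> index_set n r"
  shows "(swap_binomial n i a b :: 'k::comm_ring_1 mpoly) \<in> swap_ideal n r t"
proof -
  interpret P: cring "Rring n r :: 'k mpoly ring" unfolding Rring_def by (rule cring_poly_ring)
  show ?thesis
    using P.genideal_self[OF swap_binomials_subset_carrier[OF assms(1)]] assms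
    unfolding swap_ideal_def by blast
qed

text \<open>
  Prescribing the entry \<open>c\<close> in position \<open>i\<close> and a surplus \<open>k\<close> of the other entries over their minimum
  \<open>n - 1\<close>.  The bound on \<open>k\<close> says \<open>k \<le> mdim n r - (r i - 1)\<close>, the largest surplus that the other
  entries can reach.
\<close>

lemma ex_index_component_sum:
  assumes r: "\<forall>j\<in>{1..n}. 1 \<le> r j" and i: "i \<in> {1..n}" and c: "1 \<le> c" "c \<le> r i"
    and k: "k + r i \<le> mdim n r + 1"
  shows "\<exists>a\<in>index_set n r. a i = c \<and> (\<Sum>j=1..n. a j) = n + k + c - 1"
proof -
  have n_le: "n \<le> (\<Sum>j=1..n. r j)"
    using sum_mono[of "{1..n}" "\<lambda>_. 1" r] r by force
  have "n + k \<le> (\<Sum>j=1..n. (r(i := 1)) j)"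
    using sum_fun_upd[OF i, of r 1] k n_le by (simp add: mdim_def)
  moreover have "\<forall>j\<in>{1..n}. 1 \<le> (r(i := 1)) j" using r by simp
  \<comment> \<open>Shrinking the range in position \<open>i\<close> to one value forces the surplus into the other positions.\<close>
  ultimately obtain a where a: "a \<in> index_set n (r(i := 1))" "(\<Sum>j=1..n. a j) = n + k"
    using ex_index_sum[of n "r(i := 1)" "n + k"] by auto
  have "a i = 1" using a(1) i by (force simp: index_set_def PiE_iff)
  then have "(\<Sum>j=1..n. (a(i := c)) j) = n + k + c - 1"
    using sum_fun_upd[OF i, of a c] a(2) by simp
  moreover have "a(i := c) \<in> index_set n r"
    using a(1) c i by (auto simp: index_set_def PiE_iff extensional_def split: if_splits)
  ultimately show ?thesis by (intro bexI[of _ "a(i := c)"]) auto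
qed

text \<open>
  With \<open>e = r 1 - 1\<close>, the offsets \<open>u - 1\<close> and \<open>v - 1\<close> are split as \<open>p + \<alpha>\<close> and \<open>q + \<beta>\<close>, where
  \<open>\<alpha>, \<beta> \<le> e\<close> are the contributions of the first entries and \<open>p, q \<le> M = m - e\<close> those of the others.  If
  \<open>\<alpha> < \<beta>\<close> and \<open>p < q\<close>, exchanging the first entries gives the offsets \<open>p + \<beta>\<close> and \<open>q + \<alpha>\<close>, both
  strictly between the old ones.  Such a splitting exists as soon as \<open>e, M \<ge> 1\<close> and \<open>u + 2 \<le> v\<close>;
  \<open>M \<ge> 1\<close> is where a second factor enters.
\<close>

lemma swap_ideal_inward_move:
  assumes r: "\<forall>i\<in>{1..n}. 2 \<le> r i" and n: "2 \<le> n" and t: "t \<in> {1..n}"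
    and u: "u \<in> {1..mdim n r + 1}" and v: "v \<in> {1..mdim n r + 1}" and uv: "u + 2 \<le> v"
  shows "\<exists>w. u < w \<and> w < v \<and>
    coord u * coord v - coord w * coord (u + v - w) \<in> (swap_ideal n r t :: 'k::comm_ring_1 mpoly set)"
proof -
  define e where "e = r 1 - 1"
  define M where "M = mdim n r - e"
  have one: "1 \<in> {1..n}" and "2 \<le> r 1" using n r by auto
  then have e: "1 \<le> e" "r 1 = e + 1" by (auto simp: e_def)
  have M: "1 \<le> M" "mdim n r = M + e"
  proof -
    have "(\<Sum>i\<in>{1..n} - {1}. 2) \<le> (\<Sum>i\<in>{1..n} - {1}. r i)"
      using r by (intro sum_mono) auto
    then have "2 * (n - 1) + r 1 \<le> (\<Sum>i=1..n. r i)"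
      using sum.remove[of "{1..n}" 1 r] one by simp
    then show "1 \<le> M" "mdim n r = M + e"
      using n e by (auto simp: M_def mdim_def)
  qed
  \<comment> \<open>\<open>\<alpha>\<close> takes as much of \<open>u - 1\<close> as leaves room for a larger \<open>\<beta>\<close>, and \<open>\<beta>\<close> is the least value above
      \<open>\<alpha>\<close> for which the remainder \<open>q\<close> is at most \<open>M\<close>.\<close>
  define \<alpha> where "\<alpha> = min (u - 1) (e - 1)"
  define \<beta> where "\<beta> = max (\<alpha> + 1) (v - 1 - M)"
  define p where "p = u - 1 - \<alpha>"
  define q where "q = v - 1 - \<beta>"
  have uvM: "1 \<le> u" "v \<le> M + e + 1" using u v M by auto
  have \<alpha>: "\<alpha> + 1 \<le> e" "\<alpha> + 1 \<le> u" using uvM e by (auto simp: \<alpha>_def)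
  have p: "p + \<alpha> = u - 1" using \<alpha> by (simp add: p_def)
  have "p = 0 \<or> \<alpha> = e - 1" by (auto simp: p_def \<alpha>_def)
  then have pM: "p < M" using p \<alpha> uvM uv M by linarith
  have \<beta>: "\<alpha> < \<beta>" "\<beta> \<le> e" "v \<le> \<beta> + M + 1" "\<beta> + 1 \<le> v"
    using \<alpha> uvM uv by (auto simp: \<beta>_def)
  then have q: "q + \<beta> = v - 1" by (simp add: q_def)
  have "\<beta> = \<alpha> + 1 \<or> \<beta> + M + 1 = v" by (auto simp: \<beta>_def)
  then have "p < q" using p q pM \<alpha> \<beta> uv by linarith
  moreover have "q \<le> M" using q \<beta> by linarith
  moreover note p q \<beta>
  ultimately have *: "p + \<alpha> = u - 1" "q + \<beta> = v - 1" "\<alpha> < \<beta>" "\<beta> \<le> e" "p < q" "q \<le> M"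
    by blast+
  have r1: "\<forall>i\<in>{1..n}. 1 \<le> r i" using r by auto
  obtain a where a: "a \<in> index_set n r" "a 1 = \<alpha> + 1" "(\<Sum>j=1..n. a j) = n + p + \<alpha>"
    using ex_index_component_sum[OF r1 one, of "\<alpha> + 1" p] * M e by auto
  obtain b where b: "b \<in> index_set n r" "b 1 = \<beta> + 1" "(\<Sum>j=1..n. b j) = n + q + \<beta>"
    using ex_index_component_sum[OF r1 one, of "\<beta> + 1" q] * M e by auto
  define w where "w = p + \<beta> + 1"
  have "(\<Sum>j=1..n. sw 1 a b j) = n + p + \<beta>" "(\<Sum>j=1..n. sw 1 b a j) = n + q + \<alpha>"
    using sum_fun_upd[OF one, of a "b 1"] sum_fun_upd[OF one, of b "a 1"] a b
    unfolding sw_def by linarith+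
  moreover have uv_eq: "u = p + \<alpha> + 1" "v = q + \<beta> + 1" using * u v by auto
  moreover from uv_eq have "u + v - w = q + \<alpha> + 1" by (simp add: w_def)
  ultimately have "(swap_binomial n 1 a b :: 'k mpoly) =
      coord u * coord v - coord w * coord (u + v - w)"
    using a(3) b(3) by (simp add: swap_binomial_def xvar_def w_def ac_simps)
  then have "coord u * coord v - coord w * coord (u + v - w) \<in> (swap_ideal n r t :: 'k mpoly set)"
    using swap_binomial_in_swap_ideal[of t n 1 a r b, where 'k='k] t a(1) b(1) by auto
  moreover have "u < w" "w < v" using * u v by (auto simp: w_def)
  ultimately show ?thesis by blast
qed

lemma swap_ideal_eq_hankel_ideal:
  assumes r: "\<forall>i\<in>{1..n}. 2 \<le> r i" and t: "t \<in> {1..n}" and n1: "n = 1 \<longrightarrow> r 1 = 2"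
  shows "(swap_ideal n r t :: 'k::comm_ring_1 mpoly set) = hankel_ideal (mdim n r)"
proof
  interpret P: cring "poly_ring {1..mdim n r + 1} :: 'k mpoly ring" by (rule cring_poly_ring)
  have tn: "t \<le> n" using t by simp
  show "(swap_ideal n r t :: 'k mpoly set) \<subseteq> hankel_ideal (mdim n r)"
    unfolding swap_ideal_def Rring_def
  proof (rule P.genideal_minimal[OF ideal_hankel_ideal], clarify, goal_cases)
    case (1 p i a b)
    then have "i \<in> {1..n}" using tn by auto
    from this 1(2,3) show ?case
      by (rule swap_binomial_balanced)
        (erule ssubst, rule hankel_ideal_contains_balanced_binomials)
  qed
  have move: "\<exists>w. u < w \<and> w < v \<and>
      coord u * coord v - coord w * coord (u + v - w) \<in> (swap_ideal n r t :: 'k mpoly set)"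
    if "u \<in> {1..mdim n r + 1}" "v \<in> {1..mdim n r + 1}" "u + 2 \<le> v" for u v
  proof (cases "n = 1")
    case True
    \<comment> \<open>Only the coordinates 1 and 2 exist, so no pair is at distance two.\<close>
    then have "mdim n r = 1" using n1 by (simp add: mdim_def)
    then show ?thesis using that by auto
  next
    case False
    then have "2 \<le> n" using t by auto
    then show ?thesis using swap_ideal_inward_move[OF r _ t that] by blast
  qed
  show "hankel_ideal (mdim n r) \<subseteq> (swap_ideal n r t :: 'k mpoly set)"
    unfolding hankel_ideal_def
  proof (rule P.genideal_minimal[OF ideal_swap_ideal[OF tn]], clarify, goal_cases)
    case (1 p j l)
    then have "coord j * coord (l + 1) - coord l * coord (j + 1) \<in> (swap_ideal n r t :: 'k mpoly set)"
      by (intro ideal_contains_balanced_binomials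
          [where N = "mdim n r + 1", OF ideal_swap_ideal[OF tn] move]) auto
    then show ?case using 1 by (simp add: hankel_def)
  qed
qed

section \<open>Evaluation of polynomials\<close>

text \<open>The product inside \<open>eval_at\<close>, named so that its multiplicativity can be stated.\<close>

definition monomial_value :: "(nat \<Rightarrow> 'l::comm_ring_1) \<Rightarrow> (nat \<Rightarrow>\<^sub>0 nat) \<Rightarrow> 'l" where
  "monomial_value z \<mu> = (\<Prod>j\<in>Poly_Mapping.keys \<mu>. z j ^ Poly_Mapping.lookup \<mu> j)"

lemma monomial_value_superset:
  assumes "finite A" "Poly_Mapping.keys \<mu> \<subseteq> A"
  shows "monomial_value z \<mu> = (\<Prod>j\<in>A. z j ^ Poly_Mapping.lookup \<mu> j)"
  unfolding monomial_value_def using assms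
  by (intro prod.mono_neutral_left) (auto simp: in_keys_iff)

lemma monomial_value_add: "monomial_value z (\<mu> + \<nu>) = monomial_value z \<mu> * monomial_value z \<nu>"
proof -
  let ?A = "Poly_Mapping.keys \<mu> \<union> Poly_Mapping.keys \<nu>"
  have "Poly_Mapping.keys (\<mu> + \<nu>) \<subseteq> ?A" by (rule keys_add)
  then show ?thesis
    by (simp add: monomial_value_superset[of ?A] lookup_add power_add prod.distrib)
qed

lemma field_hom_0: "field_hom h \<Longrightarrow> h 0 = 0"
  unfolding field_hom_def by (metis add_0 add_cancel_right_left)

lemma eval_at_superset:
  assumes "field_hom h" "finite A" "Poly_Mapping.keys p \<subseteq> A"
  shows "eval_at h z p = (\<Sum>\<mu>\<in>A. h (Poly_Mapping.lookup p \<mu>) * monomial_value z \<mu>)"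
  unfolding eval_at_def monomial_value_def[symmetric] using assms
  by (intro sum.mono_neutral_left) (auto simp: in_keys_iff field_hom_0)

lemma eval_at_add:
  assumes h: "field_hom h"
  shows "eval_at h z (p + q) = eval_at h z p + eval_at h z q"
proof -
  let ?A = "Poly_Mapping.keys p \<union> Poly_Mapping.keys q"
  have "Poly_Mapping.keys (p + q) \<subseteq> ?A" by (rule keys_add)
  moreover have "h (c + d) = h c + h d" for c d using h by (simp add: field_hom_def)
  ultimately show ?thesis
    by (simp add: eval_at_superset[OF h, of ?A] lookup_add ring_distribs sum.distrib)
qed

lemma eval_at_single:
  "field_hom h \<Longrightarrow> eval_at h z (Poly_Mapping.single \<mu> c) = h c * monomial_value z \<mu>"
  by (simp add: eval_at_superset[of h "{\<mu>}"])

text \<open>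
  Both sides of the multiplicativity of evaluation are additive in each factor; this induction rule
  reduces such claims to single monomials.
\<close>

lemma poly_mapping_additive_induct [case_names single add]:
  fixes p :: "'a \<Rightarrow>\<^sub>0 'b::monoid_add"
  assumes single: "\<And>\<mu> c. P (Poly_Mapping.single \<mu> c)"
    and add: "\<And>p q. P p \<Longrightarrow> P q \<Longrightarrow> P (p + q)"
  shows "P p"
proof (induction p rule: Poly_Mapping.update_induct)
  case const
  show ?case using single[of undefined 0] by simp
next
  case (update f \<mu> c)
  then have "Poly_Mapping.update \<mu> c f = Poly_Mapping.single \<mu> c + f"
    by (intro poly_mapping_eqI)
      (auto simp: lookup_add lookup_single lookup_update in_keys_iff when_def)
  then show ?case using add[OF single update.IH] by simp
qed

lemma eval_at_mult:
  assumes h: "field_hom h"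
  shows "eval_at h z (p * q) = eval_at h z p * eval_at h z q"
proof (induction p rule: poly_mapping_additive_induct)
  case (single \<mu> c)
  show ?case
  proof (induction q rule: poly_mapping_additive_induct)
    case (single \<nu> d)
    have "h (c * d) = h c * h d" using h by (simp add: field_hom_def)
    then show ?case
      by (simp add: mult_single eval_at_single[OF h] monomial_value_add)
  qed (simp add: ring_distribs eval_at_add[OF h])
qed (simp add: ring_distribs eval_at_add[OF h])

lemma eval_at_diff:
  assumes h: "field_hom h"
  shows "eval_at h z (p - q) = eval_at h z p - eval_at h z q"
  using eval_at_add[OF h, of z "p - q" q] by simp

lemma eval_at_coord: "field_hom h \<Longrightarrow> eval_at h z (coord j) = z j"
  by (simp add: coord_def eval_at_single monomial_value_def field_hom_def)

text \<open>
  Since the kernel is an ideal, the vanishing of an ideal at a point can be tested on generators.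
\<close>

lemma ideal_eval_at_kernel:
  fixes h :: "'k::field \<Rightarrow> 'l::field"
  assumes h: "field_hom h"
  shows "ideal {p \<in> carrier (poly_ring V). eval_at h z p = 0} (poly_ring V)"
proof -
  interpret P: cring "poly_ring V :: 'k mpoly ring" by (rule cring_poly_ring)
  have zero: "eval_at h z 0 = 0" by (simp add: eval_at_def)
  show ?thesis
  proof (rule idealI)
    show "subgroup {p \<in> carrier (poly_ring V). eval_at h z p = 0} (add_monoid (poly_ring V))"
    proof (rule subgroup.intro)
      show "\<one>\<^bsub>add_monoid (poly_ring V)\<^esub> \<in> {p \<in> carrier (poly_ring V). eval_at h z p = 0}"
        using zero by (simp add: poly_ring_def)
    next
      fix p :: "'k mpoly"
      assume p: "p \<in> {p \<in> carrier (poly_ring V). eval_at h z p = 0}"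
      let ?m = "\<ominus>\<^bsub>poly_ring V\<^esub> p"
      have "?m + p = 0" using P.l_neg[of p] p by (simp add: poly_ring_def)
      then have "eval_at h z ?m = 0"
        using eval_at_add[OF h, of z ?m p] p zero by simp
      then show "inv\<^bsub>add_monoid (poly_ring V)\<^esub> p \<in> {p \<in> carrier (poly_ring V). eval_at h z p = 0}"
        using p P.a_inv_closed[of p] by (simp add: a_inv_def)
    next
      fix p q :: "'k mpoly"
      assume "p \<in> {p \<in> carrier (poly_ring V). eval_at h z p = 0}"
        "q \<in> {p \<in> carrier (poly_ring V). eval_at h z p = 0}"
      then show "p \<otimes>\<^bsub>add_monoid (poly_ring V)\<^esub> q \<in> {p \<in> carrier (poly_ring V). eval_at h z p = 0}"
        using P.a_closed[of p q] eval_at_add[OF h, of z p q] by (simp add: poly_ring_def)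
    qed auto
  next
    fix p q :: "'k mpoly"
      assume pq: "p \<in> {p \<in> carrier (poly_ring V). eval_at h z p = 0}"
      "q \<in> carrier (poly_ring V)"
    then show "q \<otimes>\<^bsub>poly_ring V\<^esub> p \<in> {p \<in> carrier (poly_ring V). eval_at h z p = 0}"
      using P.m_closed[of q p] eval_at_mult[OF h, of z q p] by (simp add: poly_ring_def)
    from pq show "p \<otimes>\<^bsub>poly_ring V\<^esub> q \<in> {p \<in> carrier (poly_ring V). eval_at h z p = 0}"
      using P.m_closed[of p q] eval_at_mult[OF h, of z p q] by (simp add: poly_ring_def)
  qed (rule P.ring_axioms)
qed

section \<open>Points of the rational normal curve\<close>

lemma zero_locus_hankel_ideal_iff:
  fixes h :: "'k::field \<Rightarrow> 'l::field"
  assumes h: "field_hom h"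
  shows "z \<in> zero_locus h m (hankel_ideal m) \<longleftrightarrow> z \<in> homogeneous_coords m \<and>
    (\<forall>j l. 1 \<le> j \<and> j < l \<and> l \<le> m \<longrightarrow> z j * z (l + 1) = z l * z (j + 1))"
proof -
  interpret P: cring "poly_ring {1..m + 1} :: 'k mpoly ring" by (rule cring_poly_ring)
  have ev: "eval_at h z (coord j * coord (l + 1) - coord l * coord (j + 1)) =
      z j * z (l + 1) - z l * z (j + 1)" for j l
    by (simp add: eval_at_diff[OF h] eval_at_mult[OF h] eval_at_coord[OF h])
  have "(\<forall>p\<in>hankel_ideal m. eval_at h z p = 0) \<longleftrightarrow>
    (\<forall>j l. 1 \<le> j \<and> j < l \<and> l \<le> m \<longrightarrow> z j * z (l + 1) = z l * z (j + 1))" (is "?L \<longleftrightarrow> ?R")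
  proof
    assume ?L
    then show ?R using hankel_minor_in_hankel_ideal[of _ _ m, where 'k='k] ev by fastforce
  next
    assume R: ?R
    have "hankel_ideal m \<subseteq> {p \<in> carrier (poly_ring {1..m + 1}). eval_at h z p = 0}"
      unfolding hankel_ideal_def
    proof (rule P.genideal_minimal[OF ideal_eval_at_kernel[OF h]], intro subsetI CollectI conjI)
      fix p :: "'k mpoly"
      assume p: "p \<in> {hankel 1 j * hankel 2 l - hankel 1 l * hankel 2 j | j l.
        1 \<le> j \<and> j < l \<and> l \<le> m}"
      then show "p \<in> carrier (poly_ring {1..m + 1})" using hankel_minors_subset_carrier by blast
      from p obtain j l where jl: "1 \<le> j" "j < l" "l \<le> m"
        and "p = hankel 1 j * hankel 2 l - hankel 1 l * hankel 2 j"
        by blast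
      then have "p = coord j * coord (l + 1) - coord l * coord (j + 1)" by (simp add: hankel_def)
      moreover have "z j * z (l + 1) = z l * z (j + 1)" using R jl by blast
      ultimately show "eval_at h z p = 0" by (simp only: ev diff_self)
    qed
    then show ?L by blast
  qed
  then show ?thesis by (simp add: zero_locus_def)
qed

text \<open>
  If \<open>z 1 \<noteq> 0\<close>, the minors of columns \<open>1\<close> and \<open>l\<close> say that consecutive coordinates have the constant
  ratio \<open>z 2 / z 1\<close>.  If \<open>z 1 = 0\<close>, the minors of adjacent columns say \<open>z\<^sub>l\<^sup>2 = z\<^sub>l\<^sub>-\<^sub>1 z\<^sub>l\<^sub>+\<^sub>1\<close> for \<open>l \<le> m\<close>,
  so zeros propagate up to \<open>z m\<close> and the point is the image of \<open>[0 : 1]\<close>.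
\<close>

lemma on_rational_normal_curve_iff:
  fixes z :: "nat \<Rightarrow> 'l::field"
  assumes z: "z \<in> homogeneous_coords m"
  shows "z \<in> rational_normal_curve m \<longleftrightarrow>
    (\<forall>j l. 1 \<le> j \<and> j < l \<and> l \<le> m \<longrightarrow> z j * z (l + 1) = z l * z (j + 1))"
proof
  assume "z \<in> rational_normal_curve m"
  then obtain u v c where zj: "\<And>j. j \<in> {1..m + 1} \<Longrightarrow> z j = c * (u ^ (m + 1 - j) * v ^ (j - 1))"
    by (auto simp: rational_normal_curve_def)
  show "\<forall>j l. 1 \<le> j \<and> j < l \<and> l \<le> m \<longrightarrow> z j * z (l + 1) = z l * z (j + 1)"
  proof (intro allI impI)
    fix j l assume jl: "1 \<le> j \<and> j < l \<and> l \<le> m"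
    have "z j = c * (u ^ (m + 1 - j) * v ^ (j - 1))" "z l = c * (u ^ (m + 1 - l) * v ^ (l - 1))"
      "z (j + 1) = c * (u ^ (m - j) * v ^ j)" "z (l + 1) = c * (u ^ (m - l) * v ^ l)"
      using zj[of j] zj[of l] zj[of "j + 1"] zj[of "l + 1"] jl by simp_all
    then have "z j * z (l + 1) = c\<^sup>2 * (u ^ ((m + 1 - j) + (m - l)) * v ^ ((j - 1) + l))"
      and "z l * z (j + 1) = c\<^sup>2 * (u ^ ((m + 1 - l) + (m - j)) * v ^ ((l - 1) + j))"
      by (simp_all only: power_add power2_eq_square mult_ac)
    moreover have "(m + 1 - j) + (m - l) = (m + 1 - l) + (m - j)" "(j - 1) + l = (l - 1) + j"
      using jl by auto
    ultimately show "z j * z (l + 1) = z l * z (j + 1)" by simp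
  qed
next
  assume minors: "\<forall>j l. 1 \<le> j \<and> j < l \<and> l \<le> m \<longrightarrow> z j * z (l + 1) = z l * z (j + 1)"
  have "\<exists>u v c. (u \<noteq> 0 \<or> v \<noteq> 0) \<and> c \<noteq> 0 \<and>
       (\<forall>j\<in>{1..m + 1}. z j = c * (u ^ (m + 1 - j) * v ^ (j - 1)))"
  proof (cases "z 1 = 0")
    case False
    have geometric: "z (Suc j) = z 1 * (z 2 / z 1) ^ j" if "j \<le> m" for j
      using that
    proof (induction j)
      case (Suc j)
      have "z 1 * z (Suc (Suc j)) = z (Suc j) * z 2"
        using minors[rule_format, of 1 "Suc j"] Suc.prems by (cases j) (auto simp: numeral_2_eq_2 mult.commute)
      then show ?case using Suc False by (simp add: field_simps)
    qed simp
    have curve: "z j = z 1 * (1 ^ (m + 1 - j) * (z 2 / z 1) ^ (j - 1))" if "j \<in> {1..m + 1}" for j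
    proof -
      have "j - 1 \<le> m" using that by auto
      then show ?thesis using geometric[of "j - 1"] that by simp
    qed
    show ?thesis
      by (rule exI[of _ 1], rule exI[of _ "z 2 / z 1"], rule exI[of _ "z 1"])
        (use False in \<open>intro conjI ballI curve; simp\<close>)
  next
    case True
    have vanish: "z (Suc j) = 0" if "Suc j \<le> m" for j
      using that
    proof (induction j)
      case 0
      then show ?case using True by simp
    next
      case (Suc j)
      then show ?case
        using minors[rule_format, of "Suc j" "Suc (Suc j)"] by simp
    qed
    then have vanish': "z j = 0" if "j \<in> {1..m}" for j using that by (cases j) auto
    obtain j where "j \<in> {1..m + 1}" "z j \<noteq> 0" using z by (auto simp: homogeneous_coords_def)
    then have last: "z (m + 1) \<noteq> 0" using vanish'[of j] by (cases "j = m + 1") auto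
    \<comment> \<open>For \<open>j = m + 1\<close> the parametrisation contains \<open>0 ^ 0 = 1\<close>.\<close>
    have curve: "z j = z (m + 1) * (0 ^ (m + 1 - j) * 1 ^ (j - 1))" if "j \<in> {1..m + 1}" for j
      using that vanish'[of j] by (cases "j = m + 1") auto
    show ?thesis
      by (rule exI[of _ 0], rule exI[of _ 1], rule exI[of _ "z (m + 1)"])
        (use last in \<open>intro conjI ballI curve; simp\<close>)
  qed
  then show "z \<in> rational_normal_curve m" using z by (simp add: rational_normal_curve_def)
qed

lemma zero_locus_hankel_ideal:
  assumes "field_hom h"
  shows "zero_locus h m (hankel_ideal m) = rational_normal_curve m"
proof (intro equalityI subsetI)
  fix z assume "z \<in> zero_locus h m (hankel_ideal m)"
  then show "z \<in> rational_normal_curve m"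
    using zero_locus_hankel_ideal_iff[OF assms] on_rational_normal_curve_iff by blast
next
  fix z :: "nat \<Rightarrow> 'b" assume z: "z \<in> rational_normal_curve m"
  then have "z \<in> homogeneous_coords m" by (simp add: rational_normal_curve_def)
  then show "z \<in> zero_locus h m (hankel_ideal m)"
    using z zero_locus_hankel_ideal_iff[OF assms] on_rational_normal_curve_iff by blast
qed

theorem corollary6p3:
  fixes n t :: nat and r :: "nat \<Rightarrow> nat"
  assumes "1 \<le> n" and "\<forall>i\<in>{1..n}. 2 \<le> r i" and "t \<in> {1..n}"
    and "n = 1 \<longrightarrow> r 1 = 2"
  shows "(swap_ideal n r t :: 'k::field mpoly set) = hankel_ideal (mdim n r) \<and>
    (\<forall>h :: 'k \<Rightarrow> 'l::field. field_hom h \<longrightarrow>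
       zero_locus h (mdim n r) (swap_ideal n r t) = rational_normal_curve (mdim n r))"
  using swap_ideal_eq_hankel_ideal[OF assms(2-4), where 'k='k] zero_locus_hankel_ideal by auto

end
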